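(* Let $L\ge 1$ be an integer, let $D=[0,1]$, and for $i,j\in\{0,\ldots,L-1\}$ let $f_{i,j}:\mathbb{R}\to\mathbb{R}$ be $1$-periodic functions having absolutely convergent Fourier series. For $i=0,\ldots,L-1$ and $\boldsymbol{y}=(y_0,\ldots,y_{L-1})\in\mathbb{R}^L$ define $$g_i(\boldsymbol{y}) := \int_{D^L}\prod_{j=0}^{L-1} f_{i,j}(x_j-x_{j+1}+y_j)\,\mathrm{d}\boldsymbol{x},\qquad \boldsymbol{x}=(x_0,\ldots,x_{L-1}),\quad x_L\equiv x_0,$$ and define $$\mathcal{I} := \int_{D^L}\cdots\int_{D^L}\prod_{i=0}^{L-1} g_i(\boldsymbol{y}_{i+1}-\boldsymbol{y}_i)\,\mathrm{d}\boldsymbol{y}_0\cdots\mathrm{d}\boldsymbol{y}_{L-1},$$ where each $\boldsymbol{y}_i=(y_{i,0},\ldots,y_{i,L-1})\in D^L$ and $\boldsymbol{y}_L\equiv\boldsymbol{y}_0$. Define $\mu_{i+jL}:=f_{i,j}$ for $i,j=0,\ldots,L-1$. Then $$\mathcal{I}=\int_{D^{L^2}}\prod_{k=0}^{L^2-1}\mu_k(x_{k+1}-x_k)\,\mathrm{d}\boldsymbol{x},$$ where now $\boldsymbol{x}=(x_0,\ldots,x_{L^2-1})$ and $x_{L^2}\equiv x_0$.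
   Context: A $1$-periodic function $f:\mathbb{R}\to\mathbb{R}$ has an absolutely convergent Fourier series if $\sum_{\ell\in\mathbb{Z}}|\widehat f(\ell)|<\infty$ and $f(x)=\sum_{\ell\in\mathbb{Z}}\widehat f(\ell)e^{2\pi \mathrm{i}\ell x}$ for all $x$, where $\widehat f(\ell)=\int_0^1 f(x)e^{-2\pi\mathrm{i}\ell x}\,\mathrm{d}x$. A function on $D=[0,1]$ that is periodic is identified with its $1$-periodic extension to $\mathbb{R}$. *)

theory Defs
  imports "HOL-Analysis.Analysis"
begin

definition unit_interval :: "real measure" where
  "unit_interval = restrict_space lborel {0..1}"

text \<open>
  Points of \<open>\<real>\<^sup>n\<close> are functions \<open>nat \<Rightarrow> real\<close> of which only the coordinates below \<open>n\<close> matter.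
\<close>
definition unit_cube :: "nat \<Rightarrow> (nat \<Rightarrow> real) measure" where
  "unit_cube n = (\<Pi>\<^sub>M j\<in>{..<n}. unit_interval)"

definition fourier_coeff :: "(real \<Rightarrow> real) \<Rightarrow> int \<Rightarrow> complex" where
  "fourier_coeff f l =
     (\<integral>x. complex_of_real (f x) * exp (- 2 * of_real pi * \<i> * of_int l * of_real x) \<partial>unit_interval)"

text \<open>
  No separate integrability condition is needed in the next definition: if \<open>f\<close> were not
  integrable on the unit interval, all its coefficients would be \<open>0\<close> by the convention for
  the Bochner integral, and the second conjunct would then force \<open>f = 0\<close>.
\<close>
definition abs_conv_fourier_series :: "(real \<Rightarrow> real) \<Rightarrow> bool" where
  "abs_conv_fourier_series f \<longleftrightarrow>
     (\<lambda>l. cmod (fourier_coeff f l)) summable_on UNIV \<and>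
     (\<forall>x. ((\<lambda>l. fourier_coeff f l * exp (2 * of_real pi * \<i> * of_int l * of_real x))
            has_sum complex_of_real (f x)) UNIV)"

text \<open>
  \<open>iterated_integral n M F\<close> is \<open>\<integral>\<dots>\<integral> F (y\<^sub>0, \<dots>, y\<^sub>n\<^sub>-\<^sub>1) dy\<^sub>0 \<dots> dy\<^sub>n\<^sub>-\<^sub>1\<close>, each \<open>y\<^sub>i\<close> ranging over \<open>M\<close>:
  the innermost integration is over \<open>y\<^sub>0\<close>, the outermost over \<open>y\<^sub>n\<^sub>-\<^sub>1\<close>.
\<close>
primrec iterated_integral :: "nat \<Rightarrow> 'a measure \<Rightarrow> ((nat \<Rightarrow> 'a) \<Rightarrow> real) \<Rightarrow> real" where
  "iterated_integral 0 M F = F (\<lambda>_. undefined)"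
| "iterated_integral (Suc n) M F = (\<integral>y. iterated_integral n M (\<lambda>v. F (v(n := y))) \<partial>M)"

text \<open>
  Here and below the cyclic conventions \<open>x\<^sub>L \<equiv> x\<^sub>0\<close> and \<open>y\<^sub>L \<equiv> y\<^sub>0\<close> are expressed by
  reducing indices modulo \<open>L\<close>.
\<close>
definition g_fun :: "nat \<Rightarrow> (nat \<Rightarrow> nat \<Rightarrow> real \<Rightarrow> real) \<Rightarrow> nat \<Rightarrow> (nat \<Rightarrow> real) \<Rightarrow> real" where
  "g_fun L f i y = (\<integral>x. (\<Prod>j<L. f i j (x j - x ((j + 1) mod L) + y j)) \<partial>unit_cube L)"

text \<open>In \<open>\<I>\<close> the \<open>j\<close>-th coordinate of the vector \<open>y\<^sub>i\<close> is \<open>y i j\<close>.\<close>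
definition I_integral :: "nat \<Rightarrow> (nat \<Rightarrow> nat \<Rightarrow> real \<Rightarrow> real) \<Rightarrow> real" where
  "I_integral L f =
     iterated_integral L (unit_cube L)
       (\<lambda>y. \<Prod>i<L. g_fun L f i (\<lambda>j. y ((i + 1) mod L) j - y i j))"

end

theory Submission
  imports Defs "HOL-Probability.Infinite_Product_Measure"
begin

text \<open>
  Both sides equal the series \<open>\<Sum>\<^sub>l \<Prod>\<^sub>i\<^sub>,\<^sub>j c\<^sub>i\<^sub>j(l)\<close>, where \<open>c\<^sub>i\<^sub>j(l)\<close> are the Fourier coefficients of
  \<open>f\<^sub>i\<^sub>j\<close>. The reason is one fact about closed chains, \<open>integral_cyclic_product\<close>: integrating
  \<open>\<Prod>\<^sub>k h\<^sub>k(x\<^sub>k\<^sub>+\<^sub>1 - x\<^sub>k)\<close> over a cyclic sequence of variables gives the sum over \<open>l\<close> of the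
  product of the \<open>l\<close>-th coefficients of the \<open>h\<^sub>k\<close>, because integrating out one variable
  convolves its two neighbouring factors and convolution multiplies coefficients.

  This fact is needed for variables of two kinds. In the inner integrals and on the
  right-hand side the \<open>x\<^sub>k\<close> are numbers in the unit interval. In the outer integral the variables
  are vectors \<open>y\<^sub>i\<close>: the inner integral \<open>g\<^sub>i(y)\<close> turns out to be a function of \<open>\<Sum>\<^sub>j y\<^sub>j\<close> alone, namely the
  one with coefficients \<open>\<Prod>\<^sub>j c\<^sub>i\<^sub>j(l)\<close> (\<open>g_fun_eq_trig_series\<close>), so the outer integral is a closed
  chain in the numbers \<open>\<Sum>\<^sub>j y\<^sub>i\<^sub>,\<^sub>j\<close>. The locale \<open>uniform_phase\<close> covers both: the convolution
  argument uses only that a real number attached to the variable is uniformly distributed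
  modulo one, that is, that all its nontrivial characters have mean zero.

  Applying the fact to the inner integrals and then to the outer one gives the series
  for \<open>\<I>\<close> (\<open>I_integral_eq_coeff_sum\<close>); applying it once, to a chain of length \<open>L\<^sup>2\<close>, gives the
  series for the right-hand side. The two differ only in the order of the factors.
\<close>

section \<open>Absolutely convergent trigonometric series\<close>

definition character :: "int \<Rightarrow> real \<Rightarrow> complex" where
  "character l x = cis (2 * pi * of_int l * x)"

definition trig_series :: "(int \<Rightarrow> complex) \<Rightarrow> real \<Rightarrow> complex" where
  "trig_series a x = (\<Sum>\<^sub>\<infinity>l. a l * character l x)"

lemma norm_character [simp]: "norm (character l x) = 1"
  by (simp add: character_def)

lemma character_zero [simp]: "character 0 x = 1" "character l 0 = 1"
  by (simp_all add: character_def)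

lemma character_add: "character l (x + y) = character l x * character l y"
  by (simp add: character_def cis_mult algebra_simps)

lemma character_sum: "character l (sum f A) = (\<Prod>j\<in>A. character l (f j))"
  by (induction A rule: infinite_finite_induct) (simp_all add: character_add)

lemma character_neg: "character (- l) (- x) = character l x"
  by (simp add: character_def)

lemma character_measurable [measurable]: "character l \<in> borel_measurable borel"
  unfolding character_def by (intro borel_measurable_continuous_onI continuous_intros)

lemma norm_trig_series_le:
  assumes "(\<lambda>l. norm (a l)) summable_on UNIV"
  shows "norm (trig_series a x) \<le> (\<Sum>\<^sub>\<infinity>l. norm (a l))"
  using norm_infsum_bound[of "\<lambda>l. a l * character l x" UNIV] assms
  by (simp add: trig_series_def norm_mult)

text \<open>
  Enumerating the integer frequencies by natural numbers makes the results on sequences of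
  functions (measurability of a limit, termwise integration) applicable.
\<close>
lemma infsum_int_eq_suminf:
  fixes u :: "int \<Rightarrow> complex"
  assumes "(\<lambda>l. norm (u l)) summable_on UNIV"
  shows "(\<Sum>\<^sub>\<infinity>l. u l) = (\<Sum>n. u (int_decode n))"
    and "summable (\<lambda>n. norm (u (int_decode n)))"
proof -
  have bij: "bij_betw int_decode UNIV UNIV"
    by (rule bij_int_decode)
  have "(\<lambda>n. u (int_decode n)) summable_on UNIV"
    using summable_on_reindex_bij_betw[OF bij, of u] abs_summable_summable[OF assms] by simp
  then have "(\<lambda>n. u (int_decode n)) sums (\<Sum>\<^sub>\<infinity>n. u (int_decode n))"
    by (intro has_sum_imp_sums) simp
  then show "(\<Sum>\<^sub>\<infinity>l. u l) = (\<Sum>n. u (int_decode n))"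
    using infsum_reindex_bij_betw[OF bij, of u] by (simp add: sums_iff)
  show "summable (\<lambda>n. norm (u (int_decode n)))"
    using summable_on_reindex_bij_betw[OF bij, of "\<lambda>l. norm (u l)"] assms
    by (intro summable_on_imp_summable) simp
qed

lemma trig_series_measurable:
  assumes "(\<lambda>l. norm (a l)) summable_on UNIV"
  shows "trig_series a \<in> borel_measurable borel"
proof -
  have "trig_series a = (\<lambda>x. \<Sum>n. a (int_decode n) * character (int_decode n) x)"
    unfolding trig_series_def
    by (intro ext infsum_int_eq_suminf(1)) (use assms in \<open>simp add: norm_mult\<close>)
  then show ?thesis by simp
qed

text \<open>
  Shifts and reflections of the argument can be absorbed into the coefficients, so that closed
  chains need to be treated only for arguments of the form \<open>x\<^sub>k\<^sub>+\<^sub>1 - x\<^sub>k\<close>.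
\<close>
lemma trig_series_shift: "trig_series a (x + c) = trig_series (\<lambda>l. a l * character l c) x"
  by (simp add: trig_series_def character_add mult_ac)

lemma trig_series_reflect: "trig_series a (- x) = trig_series (\<lambda>l. a (- l)) x"
proof -
  have "bij_betw uminus (UNIV :: int set) UNIV"
    by (rule bij_uminus)
  from infsum_reindex_bij_betw[OF this, of "\<lambda>l. a l * character l (- x)"]
  show ?thesis by (simp add: trig_series_def character_neg)
qed

text \<open>
  An absolutely summable family is bounded, by its own sum of norms.
\<close>
lemma abs_summable_mult:
  fixes a b :: "int \<Rightarrow> complex"
  assumes a: "(\<lambda>l. norm (a l)) summable_on UNIV" and b: "(\<lambda>l. norm (b l)) summable_on UNIV"
  shows "(\<lambda>l. norm (a l * b l)) summable_on UNIV"
proof (rule summable_on_comparison_test)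
  show "(\<lambda>l. norm (a l) * (\<Sum>\<^sub>\<infinity>m. norm (b m))) summable_on UNIV"
    using a by (rule summable_on_cmult_left)
  show "norm (a l * b l) \<le> norm (a l) * (\<Sum>\<^sub>\<infinity>m. norm (b m))" for l
    using finite_sum_le_infsum[OF b, of "{l}"] by (simp add: norm_mult mult_left_mono)
qed simp

lemma abs_summable_prod:
  fixes a :: "'i \<Rightarrow> int \<Rightarrow> complex"
  assumes "finite K" "K \<noteq> {}" "\<And>k. k \<in> K \<Longrightarrow> (\<lambda>l. norm (a k l)) summable_on UNIV"
  shows "(\<lambda>l. norm (\<Prod>k\<in>K. a k l)) summable_on UNIV"
  using assms
proof (induction K rule: finite_ne_induct)
  case (insert k K)
  then have "(\<lambda>l. norm (a k l * (\<Prod>k\<in>K. a k l))) summable_on UNIV"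
    by (intro abs_summable_mult) auto
  with insert show ?case by simp
qed simp

text \<open>
  Termwise integration is justified by the summable majorant \<open>B * norm (a l)\<close>, since characters
  have modulus one.
\<close>
lemma (in prob_space) integral_mult_trig_series:
  assumes a: "(\<lambda>l. norm (a l)) summable_on UNIV"
    and [measurable]: "G \<in> borel_measurable M" "\<phi> \<in> borel_measurable M"
    and G: "\<And>y. norm (G y :: complex) \<le> B"
  shows "(\<integral>y. G y * trig_series a (\<phi> y) \<partial>M) = (\<Sum>\<^sub>\<infinity>l. a l * (\<integral>y. G y * character l (\<phi> y) \<partial>M))"
proof -
  have int: "integrable M (\<lambda>y. G y * (a l * character l (\<phi> y)))" for l
  proof (rule integrable_const_bound)
    show "AE y in M. norm (G y * (a l * character l (\<phi> y))) \<le> B * norm (a l)"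
      by (simp add: norm_mult mult_right_mono[OF G])
  qed measurable
  have bound: "norm (\<integral>y. G y * (a l * character l (\<phi> y)) \<partial>M) \<le> B * norm (a l)"
    "(\<integral>y. norm (G y * (a l * character l (\<phi> y))) \<partial>M) \<le> B * norm (a l)" for l
  proof -
    have "(\<integral>y. norm (G y * (a l * character l (\<phi> y))) \<partial>M) \<le> (\<integral>y. B * norm (a l) \<partial>M)"
      by (intro integral_mono integrable_norm int) (simp_all add: norm_mult mult_right_mono[OF G])
    then show *: "(\<integral>y. norm (G y * (a l * character l (\<phi> y))) \<partial>M) \<le> B * norm (a l)"
      by (simp add: prob_space)
    show "norm (\<integral>y. G y * (a l * character l (\<phi> y)) \<partial>M) \<le> B * norm (a l)"
      using integral_norm_bound * by (rule order_trans)
  qed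
  have summ: "(\<lambda>l. norm (a l * character l x)) summable_on UNIV" for x
    using a by (simp add: norm_mult)
  have "(\<integral>y. G y * trig_series a (\<phi> y) \<partial>M)
      = (\<integral>y. (\<Sum>n. G y * (a (int_decode n) * character (int_decode n) (\<phi> y))) \<partial>M)"
    unfolding trig_series_def
    using summable_norm_cancel[OF infsum_int_eq_suminf(2)[OF summ]]
    by (intro Bochner_Integration.integral_cong refl)
      (simp add: infsum_int_eq_suminf(1)[OF summ] suminf_mult)
  also have "\<dots> = (\<Sum>n. \<integral>y. G y * (a (int_decode n) * character (int_decode n) (\<phi> y)) \<partial>M)"
  proof (rule integral_suminf[OF int])
    have "summable (\<lambda>n. norm (G y) * norm (a (int_decode n)))" for y
      by (intro summable_mult infsum_int_eq_suminf(2)[OF a])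
    then show "AE y in M. summable (\<lambda>n. norm (G y * (a (int_decode n) * character (int_decode n) (\<phi> y))))"
      by (simp add: norm_mult)
    show "summable (\<lambda>n. \<integral>y. norm (G y * (a (int_decode n) * character (int_decode n) (\<phi> y))) \<partial>M)"
    proof (rule summable_comparison_test')
      show "summable (\<lambda>n. B * norm (a (int_decode n)))"
        by (intro summable_mult infsum_int_eq_suminf(2)[OF a])
    qed (use bound in simp)
  qed
  also have "\<dots> = (\<Sum>\<^sub>\<infinity>l. \<integral>y. G y * (a l * character l (\<phi> y)) \<partial>M)"
  proof (rule infsum_int_eq_suminf(1)[symmetric], rule summable_on_comparison_test)
    show "(\<lambda>l. B * norm (a l)) summable_on UNIV"
      using a by (rule summable_on_cmult_right)
  qed (use bound in auto)
  also have "\<dots> = (\<Sum>\<^sub>\<infinity>l. a l * (\<integral>y. G y * character l (\<phi> y) \<partial>M))"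
    by (simp add: mult.left_commute[of _ "a _"])
  finally show ?thesis .
qed

section \<open>Closed chains of convolutions\<close>

lemma (in prob_space) prob_space_PiM_power: "prob_space (\<Pi>\<^sub>M k\<in>K. M)"
  by (intro prob_space_PiM prob_space_axioms)

text \<open>
  The condition on the means of the characters says that \<open>S\<close> is uniformly distributed modulo one.
\<close>
locale uniform_phase = prob_space M for M :: "'a measure" +
  fixes S :: "'a \<Rightarrow> real"
  assumes phase_measurable [measurable]: "S \<in> borel_measurable M"
    and integral_character_phase: "(\<integral>y. character l (S y) \<partial>M) = of_bool (l = 0)"
begin

text \<open>
  Termwise integration in both series leaves the integrals of
  \<open>character l (S y - s) * character m (t - S y)\<close>, and these vanish unless \<open>l = m\<close>.
\<close>
lemma convolution:
  assumes a: "(\<lambda>l. norm (a l)) summable_on UNIV" and b: "(\<lambda>l. norm (b l)) summable_on UNIV"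
  shows "(\<integral>y. trig_series a (S y - s) * trig_series b (t - S y) \<partial>M)
    = trig_series (\<lambda>l. a l * b l) (t - s)"
proof -
  note [measurable] = trig_series_measurable[OF a] trig_series_measurable[OF b]
  have orth: "(\<integral>y. character l (S y - s) * character m (t - S y) \<partial>M)
      = of_bool (m = l) * character l (t - s)" for l m
  proof -
    have "character l (S y - s) * character m (t - S y)
        = (character l (- s) * character m t) * character (l - m) (S y)" for y
      by (simp add: character_def cis_mult algebra_simps)
    then have "(\<integral>y. character l (S y - s) * character m (t - S y) \<partial>M)
        = (character l (- s) * character m t) * of_bool (l - m = 0)"
      by (simp add: integral_character_phase)
    then show ?thesis
      using character_add[of l t "- s"] by (auto simp: mult_ac)
  qed
  have "(\<integral>y. trig_series a (S y - s) * trig_series b (t - S y) \<partial>M)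
      = (\<integral>y. trig_series b (t - S y) * trig_series a (S y - s) \<partial>M)"
    by (simp add: mult.commute)
  also have "\<dots> = (\<Sum>\<^sub>\<infinity>l. a l * (\<integral>y. character l (S y - s) * trig_series b (t - S y) \<partial>M))"
    by (subst integral_mult_trig_series[OF a _ _ norm_trig_series_le[OF b]]) (simp_all add: mult.commute)
  also have "\<dots> = (\<Sum>\<^sub>\<infinity>l. a l * (b l * character l (t - s)))"
  proof (intro infsum_cong arg_cong2[where f = "(*)"] refl)
    fix l
    have "(\<integral>y. character l (S y - s) * trig_series b (t - S y) \<partial>M)
        = (\<Sum>\<^sub>\<infinity>m. b m * (of_bool (m = l) * character l (t - s)))"
      by (subst integral_mult_trig_series[OF b, where B = 1]) (simp_all add: orth)
    also have "\<dots> = (\<Sum>\<^sub>\<infinity>m\<in>{l}. b m * character l (t - s))"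
      by (rule infsum_cong_neutral) auto
    finally show "(\<integral>y. character l (S y - s) * trig_series b (t - S y) \<partial>M)
        = b l * character l (t - s)" by simp
  qed
  finally show ?thesis
    by (simp add: trig_series_def mult.assoc)
qed

text \<open>
  The last factor closes the chain and is kept apart from the product. Integrating out the last
  variable, which occurs only in the last two factors, fuses them into one
  whose coefficients are the products of theirs; what is left is a closed chain with one variable
  less. For a single variable the only factor is the constant \<open>trig_series (a 0) 0\<close>.
\<close>
lemma integral_closed_chain:
  assumes "\<And>k. k \<le> n \<Longrightarrow> (\<lambda>l. norm (a k l)) summable_on UNIV"
  shows "(\<integral>x. (\<Prod>k<n. trig_series (a k) (S (x (Suc k)) - S (x k))) * trig_series (a n) (S (x 0) - S (x n))
      \<partial>(\<Pi>\<^sub>M k\<in>{..n}. M)) = trig_series (\<lambda>l. \<Prod>k\<le>n. a k l) 0"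
  using assms
proof (induction n arbitrary: a)
  case 0
  interpret P: prob_space "\<Pi>\<^sub>M k\<in>{..0::nat}. M"
    by (rule prob_space_PiM_power)
  show ?case using P.prob_space by simp
next
  case (Suc n)
  interpret P: product_prob_space "\<lambda>_. M" UNIV
    by unfold_locales
  interpret Q: prob_space "\<Pi>\<^sub>M k\<in>{..Suc n}. M"
    by (rule prob_space_PiM_power)
  define F where "F x = (\<Prod>k<Suc n. trig_series (a k) (S (x (Suc k)) - S (x k)))
    * trig_series (a (Suc n)) (S (x 0) - S (x (Suc n)))" for x
  \<comment> \<open>the coefficients after the factors \<open>n\<close> and \<open>Suc n\<close> have been fused\<close>
  define a' where "a' = a(n := (\<lambda>l. a n l * a (Suc n) l))"
  have a': "(\<lambda>l. norm (a' k l)) summable_on UNIV" if "k \<le> n" for k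
    using that Suc.prems by (auto simp: a'_def intro!: abs_summable_mult)
  have meas: "(\<lambda>x. trig_series (a k) (S (x i) - S (x j))) \<in> borel_measurable (\<Pi>\<^sub>M k\<in>{..Suc n}. M)"
    if "k \<le> Suc n" "i \<le> Suc n" "j \<le> Suc n" for i j k
  proof -
    have "i \<in> {..Suc n}" "j \<in> {..Suc n}" using that by auto
    note [measurable] = trig_series_measurable[OF Suc.prems[OF that(1)]]
      this[THEN measurable_component_singleton, of "\<lambda>_. M"]
    show ?thesis by measurable
  qed
  have F_meas: "F \<in> borel_measurable (\<Pi>\<^sub>M k\<in>{..Suc n}. M)"
    unfolding F_def by (intro borel_measurable_times borel_measurable_prod meas) auto
  have F_int: "integrable (\<Pi>\<^sub>M k\<in>{..Suc n}. M) F"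
  proof (rule Q.integrable_const_bound[OF AE_I2 F_meas])
    fix x
    show "norm (F x) \<le> (\<Prod>k<Suc n. \<Sum>\<^sub>\<infinity>l. norm (a k l)) * (\<Sum>\<^sub>\<infinity>l. norm (a (Suc n) l))"
      unfolding F_def norm_mult prod_norm[symmetric]
      by (intro mult_mono prod_mono conjI norm_trig_series_le Suc.prems norm_ge_zero prod_nonneg infsum_nonneg) auto
  qed
  have inner: "(\<integral>y. F (x(Suc n := y)) \<partial>M)
    = (\<Prod>k<n. trig_series (a' k) (S (x (Suc k)) - S (x k))) * trig_series (a' n) (S (x 0) - S (x n))" for x
  proof -
    have "F (x(Suc n := y)) = (\<Prod>k<n. trig_series (a' k) (S (x (Suc k)) - S (x k)))
      * (trig_series (a n) (S y - S (x n)) * trig_series (a (Suc n)) (S (x 0) - S y))" for y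
      by (simp add: F_def a'_def)
    moreover have "(\<integral>y. trig_series (a n) (S y - S (x n)) * trig_series (a (Suc n)) (S (x 0) - S y) \<partial>M)
      = trig_series (a' n) (S (x 0) - S (x n))"
      by (subst convolution) (simp_all add: Suc.prems a'_def)
    ultimately show ?thesis by simp
  qed
  have "integral\<^sup>L (\<Pi>\<^sub>M k\<in>{..Suc n}. M) F = (\<integral>x. (\<integral>y. F (x(Suc n := y)) \<partial>M) \<partial>(\<Pi>\<^sub>M k\<in>{..n}. M))"
    using P.product_integral_insert[of "{..n}" "Suc n" F] F_int by (simp add: atMost_Suc)
  also have "\<dots> = trig_series (\<lambda>l. \<Prod>k\<le>n. a' k l) 0"
    unfolding inner by (rule Suc.IH) (rule a')
  also have "(\<lambda>l. \<Prod>k\<le>n. a' k l) = (\<lambda>l. \<Prod>k\<le>Suc n. a k l)"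
    by (auto simp: a'_def lessThan_Suc_atMost[symmetric] mult.assoc)
  finally show ?case by (simp add: F_def)
qed

lemma integral_cyclic_product:
  fixes n :: nat
  assumes "n \<ge> 1" "\<And>k. k < n \<Longrightarrow> (\<lambda>l. norm (a k l)) summable_on UNIV"
  shows "(\<integral>x. (\<Prod>k<n. trig_series (a k) (S (x ((k + 1) mod n)) - S (x k))) \<partial>(\<Pi>\<^sub>M k\<in>{..<n}. M))
    = (\<Sum>\<^sub>\<infinity>l. \<Prod>k<n. a k l)"
proof -
  obtain m where n: "n = Suc m"
    using assms(1) by (cases n) auto
  have "(\<Prod>k<n. trig_series (a k) (S (x ((k + 1) mod n)) - S (x k)))
    = (\<Prod>k<m. trig_series (a k) (S (x (Suc k)) - S (x k))) * trig_series (a m) (S (x 0) - S (x m))" for x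
    by (simp add: n)
  then show ?thesis
    using integral_closed_chain[of m a] assms(2)
    by (simp add: n lessThan_Suc_atMost trig_series_def)
qed

end

section \<open>Uniform phases on the unit interval and the unit cube\<close>

lemma prob_space_unit_interval: "prob_space unit_interval"
  unfolding unit_interval_def by (intro prob_space_restrict_space) auto

lemma measurable_unit_interval [measurable]: "(\<lambda>x. x) \<in> unit_interval \<rightarrow>\<^sub>M borel"
  unfolding unit_interval_def by (intro measurable_restrict_space1) simp

lemma uniform_phase_unit_interval: "uniform_phase unit_interval (\<lambda>x. x)"
proof -
  interpret prob_space unit_interval
    by (rule prob_space_unit_interval)
  show ?thesis
  proof
    show "(\<integral>x. character l x \<partial>unit_interval) = of_bool (l = 0)" for l
    proof (cases "l = 0")
      case True
      then show ?thesis by (simp add: prob_space)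
    next
      case False
      \<comment> \<open>\<open>exp (w * x) / w\<close> is an antiderivative, and it is periodic because \<open>exp w = 1\<close>\<close>
      define w where "w = 2 * pi * \<i> * of_int l"
      have w: "w \<noteq> 0" using False by (simp add: w_def)
      have ch: "character l x = exp (w * of_real x)" for x
        by (simp add: character_def cis_conv_exp w_def mult_ac)
      have "(\<integral>x. character l x \<partial>unit_interval) = (LBINT x:{0..1}. character l x)"
        by (simp add: unit_interval_def integral_restrict_space set_lebesgue_integral_def)
      also have "\<dots> = exp (w * of_real 1) / w - exp (w * of_real 0) / w"
        unfolding set_lebesgue_integral_def ch
      proof (rule integral_FTC_Icc)
        show "((\<lambda>x. exp (w * of_real x) / w) has_vector_derivative exp (w * of_real x)) (at x within {0..1})" for x
          using w by (auto intro!: derivative_eq_intros has_vector_derivative_real_field)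
        show "continuous_on {0..1} (\<lambda>x. exp (w * complex_of_real x))"
          by (intro continuous_intros)
      qed simp
      also have "exp (w * of_real 1) = 1"
        using exp_integer_2pi[of "of_int l"] by (simp add: w_def mult_ac)
      finally show ?thesis using False by simp
    qed
  qed measurable
qed

lemma prob_space_unit_cube: "prob_space (unit_cube n)"
  unfolding unit_cube_def by (intro prob_space_PiM prob_space_unit_interval)

text \<open>
  The mean of \<open>character l\<close> at the coordinate sum factorises into the means over the
  coordinates. At least one coordinate is needed: the empty sum is constantly zero, not uniform.
\<close>
lemma uniform_phase_unit_cube:
  assumes "n \<ge> 1"
  shows "uniform_phase (unit_cube n) (\<lambda>y. \<Sum>j<n. y j)"
proof -
  interpret U: uniform_phase unit_interval "\<lambda>x. x"
    by (rule uniform_phase_unit_interval)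
  interpret P: product_prob_space "\<lambda>_. unit_interval" UNIV
    by unfold_locales
  interpret prob_space "unit_cube n"
    by (rule prob_space_unit_cube)
  show ?thesis
  proof
    show "(\<lambda>y. \<Sum>j<n. y j) \<in> borel_measurable (unit_cube n)"
      unfolding unit_cube_def
    proof (rule borel_measurable_sum)
      fix j assume "j \<in> {..<n}"
      from measurable_compose[OF measurable_component_singleton[OF this, of "\<lambda>_. unit_interval"]
          measurable_unit_interval]
      show "(\<lambda>y. y j) \<in> borel_measurable (\<Pi>\<^sub>M j\<in>{..<n}. unit_interval)" .
    qed
    have "integrable unit_interval (character l)" for l
      by (rule U.integrable_const_bound[where B = 1]) (auto intro: measurable_compose[OF measurable_unit_interval])
    then show "(\<integral>y. character l (\<Sum>j<n. y j) \<partial>unit_cube n) = of_bool (l = 0)" for l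
      unfolding unit_cube_def character_sum
      using assms by (subst P.product_integral_prod) (auto simp: U.integral_character_phase)
  qed
qed

section \<open>The integrals as sums over Fourier coefficients\<close>

text \<open>
  The outermost integration of an iterated integral is over the last variable, whereas the chain
  argument integrates that variable first; passing to the product measure makes the order immaterial.
\<close>
lemma (in prob_space) iterated_integral_eq_integral_PiM:
  assumes "F \<in> borel_measurable (\<Pi>\<^sub>M k\<in>{..<n}. M)" "\<And>v. \<bar>F v\<bar> \<le> B"
  shows "iterated_integral n M F = (\<integral>v. F v \<partial>(\<Pi>\<^sub>M k\<in>{..<n}. M))"
  using assms
proof (induction n arbitrary: F)
  case 0
  then show ?case by (simp add: PiM_empty lebesgue_integral_count_space_finite)
next
  case (Suc n)
  interpret P: product_prob_space "\<lambda>_. M" UNIV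
    by unfold_locales
  interpret N: prob_space "\<Pi>\<^sub>M k\<in>{..<n}. M"
    by (rule prob_space_PiM_power)
  interpret Q: prob_space "\<Pi>\<^sub>M k\<in>{..<Suc n}. M"
    by (rule prob_space_PiM_power)
  interpret NM: pair_prob_space "\<Pi>\<^sub>M k\<in>{..<n}. M" M ..
  have F_pair: "(\<lambda>(v, y). F (v(n := y))) \<in> borel_measurable ((\<Pi>\<^sub>M k\<in>{..<n}. M) \<Otimes>\<^sub>M M)"
    using measurable_compose[OF measurable_add_dim, of F n "{..<n}" "\<lambda>_. M" borel] Suc.prems(1)
    by (simp add: lessThan_Suc split_beta')
  have "iterated_integral (Suc n) M F = (\<integral>y. (\<integral>v. F (v(n := y)) \<partial>(\<Pi>\<^sub>M k\<in>{..<n}. M)) \<partial>M)"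
    unfolding iterated_integral.simps
  proof (intro Bochner_Integration.integral_cong refl Suc.IH)
    fix y assume "y \<in> space M"
    then show "(\<lambda>v. F (v(n := y))) \<in> borel_measurable (\<Pi>\<^sub>M k\<in>{..<n}. M)"
      using measurable_compose[OF measurable_Pair2' F_pair, of y] by simp
  qed (rule Suc.prems)
  also have "\<dots> = (\<integral>v. (\<integral>y. F (v(n := y)) \<partial>M) \<partial>(\<Pi>\<^sub>M k\<in>{..<n}. M))"
  proof (rule NM.Fubini_integral)
    show "integrable ((\<Pi>\<^sub>M k\<in>{..<n}. M) \<Otimes>\<^sub>M M) (\<lambda>(v, y). F (v(n := y)))"
      by (rule NM.integrable_const_bound[OF _ F_pair, where B = B]) (auto simp: Suc.prems(2))
  qed
  also have "\<dots> = integral\<^sup>L (\<Pi>\<^sub>M k\<in>{..<Suc n}. M) F"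
  proof -
    have "integrable (\<Pi>\<^sub>M k\<in>{..<Suc n}. M) F"
      by (rule Q.integrable_const_bound[OF _ Suc.prems(1), where B = B]) (auto simp: Suc.prems(2))
    then show ?thesis
      using P.product_integral_insert[of "{..<n}" n F] by (simp add: lessThan_Suc)
  qed
  finally show ?case .
qed

lemma abs_conv_fourier_series_eq_trig_series:
  assumes "abs_conv_fourier_series f"
  shows "(\<lambda>l. norm (fourier_coeff f l)) summable_on UNIV"
    and "complex_of_real (f x) = trig_series (fourier_coeff f) x"
proof -
  show "(\<lambda>l. norm (fourier_coeff f l)) summable_on UNIV"
    using assms by (simp add: abs_conv_fourier_series_def)
  have "character l x = exp (2 * of_real pi * \<i> * of_int l * of_real x)" for l
    by (simp add: character_def cis_conv_exp mult_ac)
  then have "((\<lambda>l. fourier_coeff f l * character l x) has_sum complex_of_real (f x)) UNIV"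
    using assms by (simp add: abs_conv_fourier_series_def)
  then show "complex_of_real (f x) = trig_series (fourier_coeff f) x"
    unfolding trig_series_def by (rule infsumI[symmetric])
qed

text \<open>
  The \<open>j\<close>-th factor \<open>f i j (x\<^sub>j - x\<^sub>j\<^sub>+\<^sub>1 + y\<^sub>j)\<close> of the integrand is a reflected and shifted link of
  a closed chain. The shifts contribute \<open>\<Prod>\<^sub>j character (- l) (y\<^sub>j)\<close> to the \<open>l\<close>-th term, so only the
  sum of the \<open>y\<^sub>j\<close> matters, and replacing \<open>l\<close> by \<open>- l\<close> undoes the reflection.
\<close>
lemma g_fun_eq_trig_series:
  assumes L: "L \<ge> 1" and f: "\<And>j. j < L \<Longrightarrow> abs_conv_fourier_series (f i j)"
  shows "complex_of_real (g_fun L f i y)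
    = trig_series (\<lambda>l. \<Prod>j<L. fourier_coeff (f i j) l) (\<Sum>j<L. y j)"
proof -
  interpret U: uniform_phase unit_interval "\<lambda>x. x"
    by (rule uniform_phase_unit_interval)
  define b where "b j l = fourier_coeff (f i j) (- l) * character (- l) (y j)" for j l
  have b: "(\<lambda>l. norm (b j l)) summable_on UNIV" if "j < L" for j
  proof -
    have "(\<lambda>l. norm (fourier_coeff (f i j) (- l))) summable_on UNIV"
      using abs_conv_fourier_series_eq_trig_series(1)[OF f[OF that]]
        summable_on_reindex_bij_betw[OF bij_uminus, of "\<lambda>l. norm (fourier_coeff (f i j) l)"] by simp
    then show ?thesis by (simp add: b_def norm_mult)
  qed
  have "complex_of_real (f i j (u - v + y j)) = trig_series (b j) (v - u)" if "j < L" for j u v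
    using abs_conv_fourier_series_eq_trig_series(2)[OF f[OF that], of "u - v + y j"]
      trig_series_reflect[of "\<lambda>l. fourier_coeff (f i j) l * character l (y j)" "v - u"]
    by (simp add: trig_series_shift b_def[abs_def])
  then have "complex_of_real (g_fun L f i y)
      = (\<integral>x. (\<Prod>j<L. trig_series (b j) (x ((j + 1) mod L) - x j)) \<partial>unit_cube L)"
    unfolding g_fun_def integral_complex_of_real[symmetric]
    by (intro Bochner_Integration.integral_cong refl) simp
  also have "\<dots> = (\<Sum>\<^sub>\<infinity>l. \<Prod>j<L. b j l)"
    unfolding unit_cube_def by (rule U.integral_cyclic_product[OF L b])
  also have "\<dots> = trig_series (\<lambda>l. \<Prod>j<L. fourier_coeff (f i j) l) (\<Sum>j<L. y j)"
    using infsum_reindex_bij_betw[OF bij_uminus[where 'a = int],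
      of "\<lambda>l. (\<Prod>j<L. fourier_coeff (f i j) l) * character l (\<Sum>j<L. y j)"]
    by (simp add: trig_series_def b_def prod.distrib character_sum)
  finally show ?thesis .
qed

text \<open>
  As each \<open>g\<^sub>i\<close> is a trigonometric series in the coordinate sum of its argument, the integrand is
  a closed chain in the variables \<open>y\<^sub>i\<close> whose phase is that sum.
\<close>
lemma I_integral_eq_coeff_sum:
  assumes L: "L \<ge> 1" and f: "\<And>i j. i < L \<Longrightarrow> j < L \<Longrightarrow> abs_conv_fourier_series (f i j)"
  shows "complex_of_real (I_integral L f) = (\<Sum>\<^sub>\<infinity>l. \<Prod>i<L. \<Prod>j<L. fourier_coeff (f i j) l)"
proof -
  define S :: "(nat \<Rightarrow> real) \<Rightarrow> real" where "S y = (\<Sum>j<L. y j)" for y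
  interpret C: uniform_phase "unit_cube L" S
    unfolding S_def using L by (rule uniform_phase_unit_cube)
  define A where "A i l = (\<Prod>j<L. fourier_coeff (f i j) l)" for i l
  have A: "(\<lambda>l. norm (A i l)) summable_on UNIV" if "i < L" for i
    unfolding A_def using L abs_conv_fourier_series_eq_trig_series(1)[OF f[OF that]]
    by (intro abs_summable_prod) (auto simp: lessThan_empty_iff)
  have g: "complex_of_real (g_fun L f i (\<lambda>j. u j - v j)) = trig_series (A i) (S u - S v)"
    if "i < L" for i u v
    using g_fun_eq_trig_series[where f = f and i = i, OF L f[OF that]] by (simp add: A_def[abs_def] S_def sum_subtractf)
  define F where "F y = (\<Prod>i<L. g_fun L f i (\<lambda>j. y ((i + 1) mod L) j - y i j))" for y
  have F: "complex_of_real (F y) = (\<Prod>i<L. trig_series (A i) (S (y ((i + 1) mod L)) - S (y i)))" for y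
    by (simp add: F_def g)
  have "(\<lambda>y. complex_of_real (F y)) \<in> borel_measurable (\<Pi>\<^sub>M i\<in>{..<L}. unit_cube L)"
    unfolding F
  proof (rule borel_measurable_prod)
    fix i assume "i \<in> {..<L}"
    then have i: "i < L" "i \<in> {..<L}" "(i + 1) mod L \<in> {..<L}" by auto
    note [measurable] = trig_series_measurable[OF A[OF i(1)]]
      measurable_component_singleton[OF i(2), of "\<lambda>_. unit_cube L"]
      measurable_component_singleton[OF i(3), of "\<lambda>_. unit_cube L"]
    show "(\<lambda>y. trig_series (A i) (S (y ((i + 1) mod L)) - S (y i)))
        \<in> borel_measurable (\<Pi>\<^sub>M i\<in>{..<L}. unit_cube L)" by measurable
  qed
  from measurable_compose[OF this borel_measurable_Re] have F_meas: "F \<in> borel_measurable (\<Pi>\<^sub>M i\<in>{..<L}. unit_cube L)"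
    by simp
  have F_bound: "\<bar>F y\<bar> \<le> (\<Prod>i<L. \<Sum>\<^sub>\<infinity>l. norm (A i l))" for y
  proof -
    have "\<bar>F y\<bar> = norm (complex_of_real (F y))" by simp
    also have "\<dots> \<le> (\<Prod>i<L. \<Sum>\<^sub>\<infinity>l. norm (A i l))"
      unfolding F prod_norm[symmetric] by (intro prod_mono conjI norm_ge_zero norm_trig_series_le A) simp
    finally show ?thesis .
  qed
  have "complex_of_real (I_integral L f) = (\<integral>y. complex_of_real (F y) \<partial>(\<Pi>\<^sub>M i\<in>{..<L}. unit_cube L))"
    using C.iterated_integral_eq_integral_PiM[OF F_meas F_bound]
    by (simp add: I_integral_def F_def del: of_real_prod)
  also have "\<dots> = (\<Sum>\<^sub>\<infinity>l. \<Prod>i<L. A i l)"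
    unfolding F by (rule C.integral_cyclic_product[OF L A])
  finally show ?thesis by (simp add: A_def)
qed

theorem theorem1:
  fixes L :: nat
    and f :: "nat \<Rightarrow> nat \<Rightarrow> real \<Rightarrow> real"
    and \<mu> :: "nat \<Rightarrow> real \<Rightarrow> real"
  assumes "L \<ge> 1"
    and "\<And>i j x. i < L \<Longrightarrow> j < L \<Longrightarrow> f i j (x + 1) = f i j x"
    and "\<And>i j. i < L \<Longrightarrow> j < L \<Longrightarrow> abs_conv_fourier_series (f i j)"
    and "\<And>i j. i < L \<Longrightarrow> j < L \<Longrightarrow> \<mu> (i + j * L) = f i j"
  shows "I_integral L f =
           (\<integral>x. (\<Prod>k<L\<^sup>2. \<mu> k (x ((k + 1) mod L\<^sup>2) - x k)) \<partial>unit_cube (L\<^sup>2))"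
proof -
  interpret U: uniform_phase unit_interval "\<lambda>x. x"
    by (rule uniform_phase_unit_interval)
  have \<mu>: "abs_conv_fourier_series (\<mu> k)" if "k < L\<^sup>2" for k
  proof -
    have "k mod L < L" "k div L < L"
      using that assms(1) by (auto simp: power2_eq_square less_mult_imp_div_less)
    from assms(3,4)[OF this] show ?thesis by simp
  qed
  note coeff = abs_conv_fourier_series_eq_trig_series[OF \<mu>]
  have "complex_of_real (\<integral>x. (\<Prod>k<L\<^sup>2. \<mu> k (x ((k + 1) mod L\<^sup>2) - x k)) \<partial>unit_cube (L\<^sup>2))
      = (\<integral>x. (\<Prod>k<L\<^sup>2. trig_series (fourier_coeff (\<mu> k)) (x ((k + 1) mod L\<^sup>2) - x k)) \<partial>unit_cube (L\<^sup>2))"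
    unfolding integral_complex_of_real[symmetric]
    by (intro Bochner_Integration.integral_cong refl) (simp add: coeff)
  also have "\<dots> = (\<Sum>\<^sub>\<infinity>l. \<Prod>k<L\<^sup>2. fourier_coeff (\<mu> k) l)"
    unfolding unit_cube_def using assms(1) by (intro U.integral_cyclic_product coeff) auto
  also have "\<dots> = (\<Sum>\<^sub>\<infinity>l. \<Prod>i<L. \<Prod>j<L. fourier_coeff (f i j) l)"
  proof (rule infsum_cong)
    fix l
    \<comment> \<open>The \<open>j\<close>-th block of \<open>L\<close> consecutive indices holds the functions \<open>f i j\<close> with that \<open>j\<close>.\<close>
    have "(\<Prod>k<L\<^sup>2. fourier_coeff (\<mu> k) l) = (\<Prod>j<L. \<Prod>k\<in>{j*L..<j*L+L}. fourier_coeff (\<mu> k) l)"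
      by (simp add: prod.nat_group power2_eq_square)
    also have "\<dots> = (\<Prod>j<L. \<Prod>i<L. fourier_coeff (\<mu> (i + j * L)) l)"
      using prod.shift_bounds_nat_ivl[of _ 0 _ L]
      by (simp add: prod.atLeastLessThan_shift_0[of _ "_ * L"] atLeast0LessThan add.commute)
    also have "\<dots> = (\<Prod>j<L. \<Prod>i<L. fourier_coeff (f i j) l)"
      by (simp add: assms(4))
    also have "\<dots> = (\<Prod>i<L. \<Prod>j<L. fourier_coeff (f i j) l)"
      by (rule prod.swap)
    finally show "(\<Prod>k<L\<^sup>2. fourier_coeff (\<mu> k) l) = (\<Prod>i<L. \<Prod>j<L. fourier_coeff (f i j) l)" .
  qed
  also have "\<dots> = complex_of_real (I_integral L f)"
    using I_integral_eq_coeff_sum[OF assms(1,3)] by simp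
  finally show ?thesis
    by (simp only: of_real_eq_iff)
qed

end
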